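(* Each primitive Pythagorean triple $(x,y,z)$ has exactly four conjugate triples (triples being counted up to the signs of their first two coordinates).
   Context: A primitive Pythagorean triple is a triple $(x,y,z)$ of pairwise coprime natural (positive) numbers satisfying $x^2+y^2=z^2$, with the convention that $x$ is odd (so that $y$ is even and $z$ is odd). For coprime integers $p,q$ with $p$ even, put $$T^-(p,q)=\left(pq-q^2,\ pq-\tfrac{p^2}{2},\ \tfrac{p^2}{2}+q^2-pq\right),\qquad T^+(p,q)=\left(pq+q^2,\ pq+\tfrac{p^2}{2},\ \tfrac{p^2}{2}+q^2+pq\right).$$ The triples $T^-(p,q)$ and $T^+(p,q)$ are called conjugate to each other. Here no inequality between $p$ and $q$ is imposed, so the first two coordinates may be negative (or zero). Triples that differ only in the signs of the first two coordinates are regarded as the same triple: a triple $T'$ is conjugate to $(x,y,z)$ if, for some coprime integers $p,q$ with $p$ even, one of $T^-(p,q),T^+(p,q)$ equals $(\pm x,\pm y,z)$ for some choice of signs and the other equals $T'$ up to the signs of the first two coordinates. For example, the conjugates of $(5,12,13)$ are $(7,24,25)$, $(55,48,73)$, $(3,-4,5)$ and $(-45,-28,53)$; the degenerate triple $(1,0,1)$ is admitted as a conjugate (of $(3,4,5)$). *)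

theory Defs
  imports Main
begin

type_synonym triple = "int \<times> int \<times> int"

definition primitive_pythagorean_triple :: "triple \<Rightarrow> bool" where
  "primitive_pythagorean_triple = (\<lambda>(x, y, z).
     x > 0 \<and> y > 0 \<and> z > 0 \<and>
     coprime x y \<and> coprime x z \<and> coprime y z \<and>
     x\<^sup>2 + y\<^sup>2 = z\<^sup>2 \<and> odd x)"

text \<open>
  Both families are only used for even \<open>p\<close>, where \<open>p\<^sup>2 div 2\<close> is the exact quotient.
\<close>

definition T_minus :: "int \<Rightarrow> int \<Rightarrow> triple" where
  "T_minus p q = (p * q - q\<^sup>2, p * q - p\<^sup>2 div 2, p\<^sup>2 div 2 + q\<^sup>2 - p * q)"

definition T_plus :: "int \<Rightarrow> int \<Rightarrow> triple" where
  "T_plus p q = (p * q + q\<^sup>2, p * q + p\<^sup>2 div 2, p\<^sup>2 div 2 + q\<^sup>2 + p * q)"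

text \<open>The signs of the first two coordinates may be changed independently.\<close>

definition sign_rel :: "triple rel" where
  "sign_rel = {((x, y, z), (x', y', z')).
     (x' = x \<or> x' = - x) \<and> (y' = y \<or> y' = - y) \<and> z' = z}"

lemma equiv_sign_rel: "equiv UNIV sign_rel"
  by (rule equivI) (auto simp: sign_rel_def refl_on_def sym_def trans_def)

definition conjugate :: "triple \<Rightarrow> triple \<Rightarrow> bool" where
  "conjugate T T' \<longleftrightarrow> (\<exists>p q. coprime p q \<and> even p \<and>
     ((T_minus p q, T) \<in> sign_rel \<and> (T_plus p q, T') \<in> sign_rel \<or>
      (T_plus p q, T) \<in> sign_rel \<and> (T_minus p q, T') \<in> sign_rel))"

end

theory Submission
  imports Defs "HOL-Computational_Algebra.Nth_Powers"
begin

text \<open>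
  Substituting \<open>p = 2 r\<close> and \<open>q = r + s\<close> turns \<open>T\<^sup>-(p, q)\<close> into Euclid's triple
  \<open>(X, Y, z) = (r\<^sup>2 - s\<^sup>2, 2 r s, r\<^sup>2 + s\<^sup>2)\<close>, and \<open>T\<^sup>+(p, q)\<close> becomes the linear image
  \<open>(2 z + X + 2 Y, 2 z + 2 X + Y, 3 z + 2 X + 2 Y)\<close> of that triple. Hence the conjugates of
  \<open>(x, y, z)\<close> are these images for \<open>X = \<plusminus>x\<close>, \<open>Y = \<plusminus>y\<close>. They are pairwise inequivalent because their
  last coordinates \<open>3 z \<plusminus> 2 x \<plusminus> 2 y\<close> are distinct: \<open>x\<close> and \<open>y\<close> are nonzero and of different parity.
\<close>

text \<open>This is one of the three Berggren matrices of the tree of primitive triples. Flipping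
  one sign of \<open>X\<close>, \<open>Y\<close> gives the other two, and flipping both gives the
  inverse, up to signs.\<close>

definition conj_image :: "int \<Rightarrow> int \<Rightarrow> int \<Rightarrow> triple" where
  "conj_image z X Y = (2 * z + X + 2 * Y, 2 * z + 2 * X + Y, 3 * z + 2 * X + 2 * Y)"

lemma T_minus_param: "T_minus (2 * r) (r + s) = (r\<^sup>2 - s\<^sup>2, 2 * r * s, r\<^sup>2 + s\<^sup>2)"
proof -
  have "(2 * r)\<^sup>2 div 2 = 2 * r\<^sup>2"
    by (simp add: power_mult_distrib)
  then show ?thesis
    by (simp add: T_minus_def power2_eq_square algebra_simps)
qed

lemma T_plus_param:
  "T_plus (2 * r) (r + s) = conj_image (r\<^sup>2 + s\<^sup>2) (r\<^sup>2 - s\<^sup>2) (2 * r * s)"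
proof -
  have "(2 * r)\<^sup>2 div 2 = 2 * r\<^sup>2"
    by (simp add: power_mult_distrib)
  then show ?thesis
    by (simp add: T_plus_def conj_image_def power2_eq_square algebra_simps)
qed

text \<open>Negating \<open>p\<close> changes only the sign of \<open>p * q\<close>, which exchanges
  the two families up to the signs of the first two coordinates.\<close>

lemma T_uminus_sign_rel:
  "(T_plus (- p) q, T) \<in> sign_rel \<longleftrightarrow> (T_minus p q, T) \<in> sign_rel"
  "(T_minus (- p) q, T) \<in> sign_rel \<longleftrightarrow> (T_plus p q, T) \<in> sign_rel"
  by (cases T; auto simp: T_plus_def T_minus_def sign_rel_def)+

text \<open>Replacing \<open>p\<close> by \<open>- p\<close> turns the second alternative of
  \<open>conjugate\<close> into the first, so the given triple may always be placed in the minus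
  family.\<close>

lemma conjugate_iff:
  "conjugate T T' \<longleftrightarrow>
     (\<exists>p q. coprime p q \<and> even p \<and> (T_minus p q, T) \<in> sign_rel \<and> (T_plus p q, T') \<in> sign_rel)"
proof
  assume "conjugate T T'"
  then obtain p q where pq: "coprime p q" "even p" and
    "(T_minus p q, T) \<in> sign_rel \<and> (T_plus p q, T') \<in> sign_rel \<or>
     (T_plus p q, T) \<in> sign_rel \<and> (T_minus p q, T') \<in> sign_rel"
    unfolding conjugate_def by blast
  moreover have "coprime (- p) q" "even (- p)"
    using pq by simp_all
  ultimately show "\<exists>p q. coprime p q \<and> even p \<and> (T_minus p q, T) \<in> sign_rel \<and> (T_plus p q, T') \<in> sign_rel"
    using T_uminus_sign_rel by blast
qed (auto simp: conjugate_def)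

lemma is_square_coprime_factor_int:
  fixes a b c :: int
  assumes "a * b = c\<^sup>2" "coprime a b" "a \<ge> 0" "b \<ge> 0"
  obtains r s where "a = r\<^sup>2" "b = s\<^sup>2"
proof -
  have "nat a * nat b = (nat \<bar>c\<bar>)\<^sup>2"
    using assms by (metis nat_mult_distrib nat_power_eq power2_abs abs_ge_zero)
  moreover have cop: "coprime (nat a) (nat b)"
    using assms by (simp add: coprime_int_iff [symmetric])
  ultimately have "is_nth_power 2 (nat a * nat b)"
    by auto
  with cop have "is_nth_power 2 (nat a)" "is_nth_power 2 (nat b)"
    by (simp_all add: is_nth_power_mult_coprime_nat_iff)
  then obtain r s where "nat a = r\<^sup>2" "nat b = s\<^sup>2"
    by (auto elim!: is_nth_powerE)
  then have "a = (int r)\<^sup>2" "b = (int s)\<^sup>2"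
    using assms by (simp_all flip: of_nat_power)
  then show ?thesis
    by (rule that)
qed

text \<open>If \<open>z\<close> were even, \<open>Y\<close> would be odd too, but a sum of two odd
  squares is 2 modulo 4, while an even square is 0.\<close>

lemma odd_pythagorean_hypotenuse:
  fixes X Y z :: int
  assumes pyth: "X\<^sup>2 + Y\<^sup>2 = z\<^sup>2" and "odd X"
  shows "odd z"
proof
  assume "even z"
  then have "odd Y"
    using arg_cong [OF pyth, of even] \<open>odd X\<close> by simp
  obtain i j k where "X = 2 * i + 1" "Y = 2 * j + 1" "z = 2 * k"
    using \<open>odd X\<close> \<open>odd Y\<close> \<open>even z\<close> by (meson oddE evenE)
  then have "2 * (i\<^sup>2 + i + j\<^sup>2 + j) + 1 = 2 * k\<^sup>2"
    using pyth by (simp add: power2_eq_square algebra_simps)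
  then show False
    by presburger
qed

lemma even_pythagorean_leg:
  fixes X Y z :: int
  assumes pyth: "X\<^sup>2 + Y\<^sup>2 = z\<^sup>2" and "odd X"
  shows "even Y"
  using arg_cong [OF pyth, of even] odd_pythagorean_hypotenuse [OF assms] \<open>odd X\<close> by simp

text \<open>The halves of \<open>z + X\<close> and \<open>z - X\<close> are coprime with product
  \<open>(Y / 2)\<^sup>2\<close>, so both are squares. The legs may be negative, so that every
  choice of signs is covered.\<close>

lemma euclid_parametrization:
  fixes X Y z :: int
  assumes pyth: "X\<^sup>2 + Y\<^sup>2 = z\<^sup>2" and "odd X" "z > 0" and cop: "coprime X z"
  obtains r s where "X = r\<^sup>2 - s\<^sup>2" "Y = 2 * r * s" "z = r\<^sup>2 + s\<^sup>2" "coprime (2 * r) (r + s)"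
proof -
  have "even (z + X)" "even (z - X)"
    using odd_pythagorean_hypotenuse [OF pyth] \<open>odd X\<close> by simp_all
  then obtain a b where a: "z + X = 2 * a" and b: "z - X = 2 * b"
    by (meson evenE)
  have z: "z = a + b" and X: "X = a - b"
    using a b by linarith+
  obtain c where c: "Y = 2 * c"
    using even_pythagorean_leg [OF pyth \<open>odd X\<close>] by blast
  have ab: "a * b = c\<^sup>2"
    using pyth unfolding z X c by (simp add: power2_eq_square algebra_simps)
  have coprime_ab: "coprime a b"
  proof (rule coprimeI)
    fix d assume "d dvd a" "d dvd b"
    then have "d dvd X" "d dvd z"
      unfolding z X by simp_all
    with cop show "is_unit d"
      by (rule coprime_common_divisor)
  qed
  have "X\<^sup>2 \<le> z\<^sup>2"
    using pyth zero_le_power2 [of Y] by linarith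
  then have "\<bar>X\<bar> \<le> z"
    using \<open>z > 0\<close> by (simp add: abs_le_square_iff [symmetric])
  then have "a \<ge> 0" "b \<ge> 0"
    using a b by auto
  then obtain r t where r: "a = r\<^sup>2" and t: "b = t\<^sup>2"
    using is_square_coprime_factor_int ab coprime_ab by metis
  have "c\<^sup>2 = (r * t)\<^sup>2"
    using ab r t by (simp add: power_mult_distrib)
  \<comment> \<open>The root \<open>t\<close> of \<open>b\<close> is fixed only up to sign; taking
    \<open>s\<close> as \<open>t\<close> or \<open>- t\<close> absorbs the sign of
    \<open>Y\<close>.\<close>
  then have "c = r * t \<or> c = r * (- t)"
    by (simp add: power2_eq_iff)
  moreover have "(- t)\<^sup>2 = t\<^sup>2"
    by simp
  ultimately obtain s where s: "b = s\<^sup>2" "c = r * s"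
    using t by metis
  have "coprime r s"
    using coprime_ab r s by simp
  then have "coprime r (r + s)"
    by (simp add: coprime_iff_gcd_eq_1)
  \<comment> \<open>The sum \<open>r + s\<close> has the parity of
    \<open>r\<^sup>2 - s\<^sup>2 = X\<close>, which is odd.\<close>
  moreover have "coprime 2 (r + s)"
    using \<open>odd X\<close> X r s by simp
  ultimately have "coprime (2 * r) (r + s)"
    by simp
  then show thesis
    using that [of r s] X z c r s by simp
qed

text \<open>Forwards, the parameters of a conjugate pair determine the signed legs \<open>X\<close>
  and \<open>Y\<close>. Backwards, each choice of signs has its own Euclid parameters, which supply
  \<open>p\<close> and \<open>q\<close>.\<close>

lemma conjugate_iff_conj_image:
  assumes "primitive_pythagorean_triple (x, y, z)"
  shows "conjugate (x, y, z) T' \<longleftrightarrow>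
    (\<exists>X\<in>{x, - x}. \<exists>Y\<in>{y, - y}. (conj_image z X Y, T') \<in> sign_rel)"
proof
  assume "conjugate (x, y, z) T'"
  then obtain p q where "even p"
    and *: "(T_minus p q, (x, y, z)) \<in> sign_rel" "(T_plus p q, T') \<in> sign_rel"
    unfolding conjugate_iff by blast
  then obtain r where p: "p = 2 * r"
    by blast
  define s where "s = q - r"
  then have q: "q = r + s"
    by simp
  have "r\<^sup>2 - s\<^sup>2 \<in> {x, - x}" "2 * r * s \<in> {y, - y}" "z = r\<^sup>2 + s\<^sup>2"
    using *(1) unfolding p q T_minus_param by (auto simp: sign_rel_def)
  then show "\<exists>X\<in>{x, - x}. \<exists>Y\<in>{y, - y}. (conj_image z X Y, T') \<in> sign_rel"
    using *(2) unfolding p q T_plus_param by blast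
next
  assume "\<exists>X\<in>{x, - x}. \<exists>Y\<in>{y, - y}. (conj_image z X Y, T') \<in> sign_rel"
  then obtain X Y where XY: "X \<in> {x, - x}" "Y \<in> {y, - y}"
    and T': "(conj_image z X Y, T') \<in> sign_rel"
    by blast
  have "X\<^sup>2 + Y\<^sup>2 = z\<^sup>2" "odd X" "z > 0" "coprime X z"
    using assms XY by (auto simp: primitive_pythagorean_triple_def)
  then obtain r s where rs: "X = r\<^sup>2 - s\<^sup>2" "Y = 2 * r * s" "z = r\<^sup>2 + s\<^sup>2"
    and "coprime (2 * r) (r + s)"
    by (rule euclid_parametrization)
  moreover have "(T_minus (2 * r) (r + s), (x, y, z)) \<in> sign_rel"
    unfolding T_minus_param rs [symmetric] using XY by (auto simp: sign_rel_def)
  moreover have "(T_plus (2 * r) (r + s), T') \<in> sign_rel"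
    unfolding T_plus_param rs [symmetric] by (rule T')
  ultimately show "conjugate (x, y, z) T'"
    unfolding conjugate_iff using dvd_triv_left by blast
qed

theorem theorem3:
  fixes x y z :: int
  assumes "primitive_pythagorean_triple (x, y, z)"
  shows "card ({T'. conjugate (x, y, z) T'} // sign_rel) = 4"
proof -
  define C where "C = (\<lambda>(X, Y). sign_rel `` {conj_image z X Y})"
  define S where "S = {x, - x} \<times> {y, - y}"
  have pos: "x > 0" "y > 0" and pyth: "x\<^sup>2 + y\<^sup>2 = z\<^sup>2" and "odd x"
    using assms by (simp_all add: primitive_pythagorean_triple_def)
  have "even y"
    using pyth \<open>odd x\<close> by (rule even_pythagorean_leg)
  with \<open>odd x\<close> have neq: "x \<noteq> y"
    by blast
  have "{T'. conjugate (x, y, z) T'} // sign_rel = C ` S"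
  proof (intro equalityI subsetI)
    fix A assume "A \<in> {T'. conjugate (x, y, z) T'} // sign_rel"
    then obtain T' where T': "conjugate (x, y, z) T'" and A: "A = sign_rel `` {T'}"
      by (auto elim: quotientE)
    then obtain X Y where "(X, Y) \<in> S" "(conj_image z X Y, T') \<in> sign_rel"
      unfolding conjugate_iff_conj_image [OF assms] S_def by blast
    moreover from this have "A = C (X, Y)"
      using equiv_class_eq [OF equiv_sign_rel] by (simp add: A C_def)
    ultimately show "A \<in> C ` S"
      by blast
  next
    fix A assume "A \<in> C ` S"
    then obtain X Y where XY: "(X, Y) \<in> S" and A: "A = sign_rel `` {conj_image z X Y}"
      by (auto simp: C_def)
    have "(conj_image z X Y, conj_image z X Y) \<in> sign_rel"
      by (simp add: sign_rel_def conj_image_def)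
    then have "conjugate (x, y, z) (conj_image z X Y)"
      unfolding conjugate_iff_conj_image [OF assms] using XY by (auto simp only: S_def)
    then show "A \<in> {T'. conjugate (x, y, z) T'} // sign_rel"
      unfolding A by (intro quotientI) simp
  qed
  moreover have "inj_on C S"
  proof (rule inj_onI, clarify)
    fix X Y X' Y'
    assume S: "(X, Y) \<in> S" "(X', Y') \<in> S" and "C (X, Y) = C (X', Y')"
    then have "(conj_image z X Y, conj_image z X' Y') \<in> sign_rel"
      by (simp add: C_def eq_equiv_class_iff [OF equiv_sign_rel])
    \<comment> \<open>The last coordinate \<open>3 * z + 2 * (X + Y)\<close> is untouched by sign
      changes.\<close>
    then have "X + Y = X' + Y'"
      by (auto simp: sign_rel_def conj_image_def)
    \<comment> \<open>Two of the sums \<plusminus>\<open>x\<close> \<plusminus>\<open>y\<close> with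
      different signs agree only if \<open>x = 0\<close>, \<open>y = 0\<close>, \<open>x = y\<close>
      or \<open>x = - y\<close>.\<close>
    then show "X = X' \<and> Y = Y'"
      using S pos neq by (auto simp: S_def)
  qed
  moreover have "card S = 4"
    using pos by (simp add: S_def card_cartesian_product)
  ultimately show ?thesis
    by (simp add: card_image)
qed

end
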